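(* Let $S,\Sigma\subset\Omega$ be measurable with $0<\mu(S),\mu(\Sigma)<\infty$, and let $\varepsilon,\varepsilon_1,\varepsilon_2\in(0,1)$. (1) If $f\in L^2(\varepsilon_1,\varepsilon_2,S,\Sigma)$, then $f$ is $(\varepsilon_1+\varepsilon_2)$-localized with respect to $F_\Sigma E_S$ and $(2\varepsilon_1+\varepsilon_2)$-localized with respect to $L_{S,\Sigma}$. (2) If $f\in L^2(\Omega,\mu)$ is $\varepsilon$-localized with respect to $L_{S,\Sigma}$, then $\langle f-L_{S,\Sigma}f,f\rangle_\mu\le(\varepsilon^2+\varepsilon)\|f\|_{2,\mu}^2$. (3) If a nonzero $f\in L^2(\Omega,\mu)$ satisfies $\langle f-L_{S,\Sigma}f,f\rangle_\mu\le\varepsilon\|f\|_{2,\mu}^2$, then $f$ is $\sqrt{\varepsilon}$-localized with respect to $L_{S,\Sigma}$. (4) If $f\in L^2(\varepsilon_1,\varepsilon_2,S,\Sigma)$, then $\langle f-L_{S,\Sigma}f,f\rangle_\mu<(2\varepsilon_1+\varepsilon_2)\|f\|_{2,\mu}^2$.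
   Context: Setting: $\Omega\subset\mathbb{R}^d$ is a convex cone ($\lambda x\in\Omega$ for all $\lambda>0$, $x\in\Omega$) with non-empty interior, endowed with a Borel measure $\mu$, absolutely continuous with respect to Lebesgue measure, with polar decomposition $d\mu(r\zeta)=r^{2a-1}\,dr\,Q(\zeta)\,d\omega(\zeta)$, where $a>0$, $d\omega$ is the surface measure on the unit sphere $\mathbb{S}^{d-1}$, and $Q\in L^1(\mathbb{S}^{d-1},d\omega)$, $Q\ne 0$ (so $\mu$ is homogeneous of degree $2a$). $\|\cdot\|_{p,\mu}$ is the norm of $L^p(\Omega,\mu)$ and $\langle f,g\rangle_\mu=\int_\Omega f\overline{g}\,d\mu$. The kernel $\mathcal{K}:\Omega\times\Omega\to\mathbb{C}$ is continuous, bounded ($|\mathcal{K}(x,\xi)|\le c_{\mathcal{K}}$) and homogeneous ($\mathcal{K}(\lambda x,\xi)=\mathcal{K}(x,\lambda\xi)$ for $\lambda>0$). The operator $\mathcal{T}$ is $\mathcal{T}f(\xi)=\int_\Omega f(x)\mathcal{K}(x,\xi)\,d\mu(x)$. It is assumed that (i) (inversion) if $f,\mathcal{T}f\in L^1(\Omega,\mu)$ then $f$ is continuous and $f(x)=\int_\Omega\mathcal{T}f(\xi)\overline{\mathcal{K}(x,\xi)}\,d\mu(\xi)$ for almost every $x$; (ii) (Parseval) $\langle\mathcal{T}f,\mathcal{T}g\rangle_\mu=\langle f,g\rangle_\mu$ for Schwartz functions $f,g$ on $\Omega$; in particular $\mathcal{T}$ extends to a unitary operator of $L^2(\Omega,\mu)$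 onto itself, with $\mathcal{T}^{-1}f=\overline{\mathcal{T}\overline{f}}$. For measurable $A\subset\Omega$, $A^c=\Omega\setminus A$, $E_Af=\chi_Af$ and $F_Af=\mathcal{T}^{-1}[\chi_A\mathcal{T}f]$ on $L^2(\Omega,\mu)$; $L_{S,\Sigma}=E_SF_\Sigma E_S$, a positive self-adjoint operator. $L^2(\varepsilon_1,\varepsilon_2,S,\Sigma)$ is the set of nonzero $f\in L^2(\Omega,\mu)$ with $\|E_{S^c}f\|_{2,\mu}\le\varepsilon_1\|f\|_{2,\mu}$ and $\|F_{\Sigma^c}f\|_{2,\mu}\le\varepsilon_2\|f\|_{2,\mu}$. For $\eta\ge 0$, a nonzero $f\in L^2(\Omega,\mu)$ is $\eta$-localized with respect to a bounded operator $L$ on $L^2(\Omega,\mu)$ if $\|Lf-f\|_{2,\mu}\le\eta\|f\|_{2,\mu}$. *)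

theory Defs
  imports "HOL-Analysis.Analysis" "HOL-Library.Complex_Order"
begin

section \<open>Schwartz functions\<close>

primrec iterated_derivative ::
    "'a::euclidean_space list \<Rightarrow> ('a \<Rightarrow> complex) \<Rightarrow> 'a \<Rightarrow> complex" where
  "iterated_derivative [] f = f"
| "iterated_derivative (v # vs) f =
     (\<lambda>x. frechet_derivative (iterated_derivative vs f) (at x) v)"

text \<open>Smoothness is the requirement that all iterated partial derivatives exist and are
  differentiable everywhere.  The Schwartz functions on a subset of the space are the
  restrictions of these functions; since the measure \<open>\<mu>\<close> below lives on that subset, the
  restriction is never written.\<close>

definition schwartz :: "('a::euclidean_space \<Rightarrow> complex) \<Rightarrow> bool" where
  "schwartz f \<longleftrightarrow>
     (\<forall>vs\<in>lists Basis.
        (\<forall>x. iterated_derivative vs f differentiable (at x)) \<and>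
        (\<forall>k::nat. \<exists>C. \<forall>x. (1 + norm x) ^ k * norm (iterated_derivative vs f x) \<le> C))"

section \<open>The surface measure of the unit sphere\<close>

text \<open>The normalised cone measure: a set \<open>B\<close> of directions has measure \<open>d\<close> times the
  Lebesgue measure of the part of the unit ball lying over \<open>B\<close>.  On the round sphere this is
  the usual surface measure, normalised so that \<open>dx = r\<^sup>d\<^sup>-\<^sup>1 dr d\<omega>\<close>.  It is a measure on the whole
  space that is concentrated on the unit sphere: \<open>sgn x = x /\<^sub>R norm x\<close> has norm 1 except
  at the origin.  It is completed because the set of directions of a convex cone need not be
  Borel.\<close>

definition surface_measure :: "'a::euclidean_space measure" where
  "surface_measure =
     completion (distr (density lborel (\<lambda>x. of_nat DIM('a) * indicator (ball 0 1) x)) borel sgn)"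

section \<open>Square-integrable functions and operators on them\<close>

text \<open>Elements of \<open>L\<^sup>2(\<mu>)\<close> are represented by functions, equality being almost everywhere.
  An operator is a map on representatives; an operator that is linear (almost everywhere) and
  bounded respects equality almost everywhere.\<close>

definition L2_space :: "'a measure \<Rightarrow> ('a \<Rightarrow> complex) set" where
  "L2_space \<mu> = {f \<in> borel_measurable \<mu>. integrable \<mu> (\<lambda>x. (norm (f x))\<^sup>2)}"

definition L2_norm :: "'a measure \<Rightarrow> ('a \<Rightarrow> complex) \<Rightarrow> real" where
  "L2_norm \<mu> f = sqrt (\<integral>x. (norm (f x))\<^sup>2 \<partial>\<mu>)"

definition L2_inner :: "'a measure \<Rightarrow> ('a \<Rightarrow> complex) \<Rightarrow> ('a \<Rightarrow> complex) \<Rightarrow> complex" where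
  "L2_inner \<mu> f g = (\<integral>x. f x * cnj (g x) \<partial>\<mu>)"

definition L2_nonzero :: "'a measure \<Rightarrow> ('a \<Rightarrow> complex) \<Rightarrow> bool" where
  "L2_nonzero \<mu> f \<longleftrightarrow> f \<in> L2_space \<mu> \<and> \<not> (AE x in \<mu>. f x = 0)"

type_synonym 'a operator = "('a \<Rightarrow> complex) \<Rightarrow> 'a \<Rightarrow> complex"

definition L2_linear :: "'a measure \<Rightarrow> 'a operator \<Rightarrow> bool" where
  "L2_linear \<mu> U \<longleftrightarrow>
     (\<forall>f\<in>L2_space \<mu>. U f \<in> L2_space \<mu>) \<and>
     (\<forall>f\<in>L2_space \<mu>. \<forall>g\<in>L2_space \<mu>. \<forall>\<alpha> \<beta>.
        AE x in \<mu>. U (\<lambda>y. \<alpha> * f y + \<beta> * g y) x = \<alpha> * U f x + \<beta> * U g x)"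

definition L2_bounded :: "'a measure \<Rightarrow> 'a operator \<Rightarrow> bool" where
  "L2_bounded \<mu> U \<longleftrightarrow>
     L2_linear \<mu> U \<and> (\<exists>C. \<forall>f\<in>L2_space \<mu>. L2_norm \<mu> (U f) \<le> C * L2_norm \<mu> f)"

definition L2_unitary :: "'a measure \<Rightarrow> 'a operator \<Rightarrow> bool" where
  "L2_unitary \<mu> U \<longleftrightarrow>
     L2_linear \<mu> U \<and>
     (\<forall>f\<in>L2_space \<mu>. \<forall>g\<in>L2_space \<mu>. L2_inner \<mu> (U f) (U g) = L2_inner \<mu> f g) \<and>
     (\<forall>g\<in>L2_space \<mu>. \<exists>f\<in>L2_space \<mu>. AE x in \<mu>. U f x = g x)"

definition L2_inv :: "'a measure \<Rightarrow> 'a operator \<Rightarrow> 'a operator" where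
  "L2_inv \<mu> U g = (SOME f. f \<in> L2_space \<mu> \<and> (AE x in \<mu>. U f x = g x))"

section \<open>The integral operator\<close>

definition int_transform ::
    "'a measure \<Rightarrow> ('a \<Rightarrow> 'a \<Rightarrow> complex) \<Rightarrow> ('a \<Rightarrow> complex) \<Rightarrow> 'a \<Rightarrow> complex" where
  "int_transform \<mu> \<K> f \<xi> = (\<integral>x. f x * \<K> x \<xi> \<partial>\<mu>)"

text \<open>In \<open>inversion\<close>, continuity of \<open>f\<close> is continuity of a representative, as \<open>f\<close> is given only
  up to null sets.  The operator \<open>\<T>\<close> is the unitary extension to \<open>L\<^sup>2(\<mu>)\<close> of the integral
  operator \<open>int_transform \<mu> \<K>\<close> on Schwartz functions; by density of the latter it is unique up to
  null sets.  That it is onto is not implied by \<open>inversion\<close> and \<open>parseval\<close>: composing the Fourier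
  transform of the plane with the isometry \<open>f \<mapsto> f \<circ> D\<close>, where \<open>D\<close> doubles the polar angle, gives
  a transform with kernel \<open>(x,\<xi>) \<mapsto> cos \<langle>y,\<xi>\<rangle>\<close>, \<open>D y = x\<close>, whose range consists of even functions.\<close>

locale integral_operator =
  fixes \<Omega> :: "'a::euclidean_space set"
    and \<mu> :: "'a measure"
    and a :: real
    and Q :: "'a \<Rightarrow> real"
    and \<K> :: "'a \<Rightarrow> 'a \<Rightarrow> complex"
    and \<T> :: "('a \<Rightarrow> complex) \<Rightarrow> 'a \<Rightarrow> complex"
  assumes convex_domain: "convex \<Omega>"
    and cone_domain: "\<And>x c. x \<in> \<Omega> \<Longrightarrow> c > 0 \<Longrightarrow> c *\<^sub>R x \<in> \<Omega>"
    and interior_domain: "interior \<Omega> \<noteq> {}"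
    and space_mu: "space \<mu> = \<Omega>"
    and sets_mu: "sets \<mu> = sets (restrict_space borel \<Omega>)"
    and absolutely_continuous_mu: "\<And>N. N \<in> null_sets lborel \<Longrightarrow> \<Omega> \<inter> N \<in> null_sets \<mu>"
    and a_pos: "a > 0"
    and Q_integrable: "integrable surface_measure Q"
    and Q_nonneg: "AE \<zeta> in surface_measure. 0 \<le> Q \<zeta>"
    and Q_nonzero: "\<not> (AE \<zeta> in surface_measure. Q \<zeta> = 0)"
    and polar_mu: "\<And>A. A \<in> sets \<mu> \<Longrightarrow>
      emeasure \<mu> A =
        (\<integral>\<^sup>+\<zeta>. ennreal (Q \<zeta>) *
           (\<integral>\<^sup>+r\<in>{0<..}. (ennreal (r powr (2 * a - 1)) * indicator A (r *\<^sub>R \<zeta>)) \<partial>lborel)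
         \<partial>surface_measure)"
    and kernel_continuous: "continuous_on (\<Omega> \<times> \<Omega>) (\<lambda>(x, \<xi>). \<K> x \<xi>)"
    and kernel_bounded: "\<exists>c. \<forall>x\<in>\<Omega>. \<forall>\<xi>\<in>\<Omega>. norm (\<K> x \<xi>) \<le> c"
    and kernel_homogeneous:
      "\<And>x \<xi> c. x \<in> \<Omega> \<Longrightarrow> \<xi> \<in> \<Omega> \<Longrightarrow> c > 0 \<Longrightarrow> \<K> (c *\<^sub>R x) \<xi> = \<K> x (c *\<^sub>R \<xi>)"
    and inversion: "\<And>f. integrable \<mu> f \<Longrightarrow> integrable \<mu> (int_transform \<mu> \<K> f) \<Longrightarrow>
      (\<exists>g. continuous_on \<Omega> g \<and> (AE x in \<mu>. f x = g x)) \<and>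
      (AE x in \<mu>. f x = (\<integral>\<xi>. int_transform \<mu> \<K> f \<xi> * cnj (\<K> x \<xi>) \<partial>\<mu>))"
    and parseval: "\<And>f g. schwartz f \<Longrightarrow> schwartz g \<Longrightarrow>
      L2_inner \<mu> (int_transform \<mu> \<K> f) (int_transform \<mu> \<K> g) = L2_inner \<mu> f g"
    and unitary: "L2_unitary \<mu> \<T>"
    and extends: "\<And>f. schwartz f \<Longrightarrow> AE \<xi> in \<mu>. \<T> f \<xi> = int_transform \<mu> \<K> f \<xi>"

section \<open>Concentration and localization\<close>

definition E_op :: "'a set \<Rightarrow> 'a operator" where
  "E_op A f = (\<lambda>x. indicator A x * f x)"

definition F_op :: "'a measure \<Rightarrow> 'a operator \<Rightarrow> 'a set \<Rightarrow> 'a operator" where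
  "F_op \<mu> \<T> A f = L2_inv \<mu> \<T> (\<lambda>\<xi>. indicator A \<xi> * \<T> f \<xi>)"

definition L_op :: "'a measure \<Rightarrow> 'a operator \<Rightarrow> 'a set \<Rightarrow> 'a set \<Rightarrow> 'a operator" where
  "L_op \<mu> \<T> S \<Sigma> f = E_op S (F_op \<mu> \<T> \<Sigma> (E_op S f))"

definition L2_concentrated ::
    "'a measure \<Rightarrow> 'a operator \<Rightarrow> real \<Rightarrow> real \<Rightarrow> 'a set \<Rightarrow> 'a set \<Rightarrow> ('a \<Rightarrow> complex) set" where
  "L2_concentrated \<mu> \<T> \<epsilon>1 \<epsilon>2 S \<Sigma> =
     {f. L2_nonzero \<mu> f \<and>
         L2_norm \<mu> (E_op (space \<mu> - S) f) \<le> \<epsilon>1 * L2_norm \<mu> f \<and>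
         L2_norm \<mu> (F_op \<mu> \<T> (space \<mu> - \<Sigma>) f) \<le> \<epsilon>2 * L2_norm \<mu> f}"

definition localized :: "'a measure \<Rightarrow> 'a operator \<Rightarrow> real \<Rightarrow> ('a \<Rightarrow> complex) \<Rightarrow> bool" where
  "localized \<mu> L \<eta> f \<longleftrightarrow>
     L2_bounded \<mu> L \<and> \<eta> \<ge> 0 \<and> L2_nonzero \<mu> f \<and>
     L2_norm \<mu> (\<lambda>x. L f x - f x) \<le> \<eta> * L2_norm \<mu> f"

end

theory Submission
  imports Defs
begin

text \<open>
  Since \<open>\<T>\<close> is unitary, \<open>F\<^sub>\<Sigma>\<close> is an orthogonal projection of \<open>L\<^sup>2(\<mu>)\<close>. Writing \<open>E = E\<^sub>S\<close>,
  \<open>F = F\<^sub>\<Sigma>\<close> for the two projections and \<open>E'\<close>, \<open>F'\<close> for the complementary ones, one has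
  \<open>f - E F E f = E' f + E F' E f\<close>, an orthogonal sum, and therefore
  \<open>\<langle>f - E F E f, f\<rangle> = \<parallel>E' f\<parallel>\<^sup>2 + \<parallel>F' E f\<parallel>\<^sup>2\<close>. The strict inequality in (4) comes from
  \<open>\<parallel>F' E f\<parallel>\<^sup>2 \<le> \<parallel>F' E f\<parallel> \<parallel>f\<parallel> \<le> (\<epsilon>1 + \<epsilon>2) \<parallel>f\<parallel>\<^sup>2\<close> and \<open>\<epsilon>1\<^sup>2 < \<epsilon>1\<close>.\<close>

section \<open>The semi-inner product on square-integrable functions\<close>

text \<open>The bound \<open>|u + v|^2 \<le> 2 |u|^2 + 2 |v|^2\<close> dominates the integrand
  pointwise. The form with two coefficients matches the linearity clause of
  \<open>L2_linear\<close>.\<close>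

lemma L2_space_lin:
  assumes "f \<in> L2_space \<mu>" "g \<in> L2_space \<mu>"
  shows "(\<lambda>x. \<alpha> * f x + \<beta> * g x) \<in> L2_space \<mu>"
proof -
  have [measurable]: "f \<in> borel_measurable \<mu>" "g \<in> borel_measurable \<mu>"
    using assms by (auto simp: L2_space_def)
  have le: "(norm (\<alpha> * f x + \<beta> * g x))\<^sup>2
      \<le> 2 * (norm \<alpha>)\<^sup>2 * (norm (f x))\<^sup>2 + 2 * (norm \<beta>)\<^sup>2 * (norm (g x))\<^sup>2" for x
  proof -
    have "(norm (\<alpha> * f x + \<beta> * g x))\<^sup>2 \<le> (norm (\<alpha> * f x) + norm (\<beta> * g x))\<^sup>2"
      by (intro power_mono norm_triangle_ineq) auto
    also have "\<dots> \<le> 2 * (norm (\<alpha> * f x))\<^sup>2 + 2 * (norm (\<beta> * g x))\<^sup>2"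
      using sum_squares_bound[of "norm (\<alpha> * f x)" "norm (\<beta> * g x)"] by (simp add: power2_sum)
    finally show ?thesis
      by (simp add: norm_mult power_mult_distrib mult.assoc)
  qed
  have "integrable \<mu> (\<lambda>x. 2 * (norm \<alpha>)\<^sup>2 * (norm (f x))\<^sup>2 + 2 * (norm \<beta>)\<^sup>2 * (norm (g x))\<^sup>2)"
    using assms by (auto simp: L2_space_def)
  then have "integrable \<mu> (\<lambda>x. (norm (\<alpha> * f x + \<beta> * g x))\<^sup>2)"
    by (rule Bochner_Integration.integrable_bound) (use le in \<open>auto intro: order_trans\<close>)
  then show ?thesis by (simp add: L2_space_def)
qed

lemma L2_space_add:
  "f \<in> L2_space \<mu> \<Longrightarrow> g \<in> L2_space \<mu> \<Longrightarrow> (\<lambda>x. f x + g x) \<in> L2_space \<mu>"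
  using L2_space_lin[of f \<mu> g 1 1] by simp

lemma L2_space_diff:
  "f \<in> L2_space \<mu> \<Longrightarrow> g \<in> L2_space \<mu> \<Longrightarrow> (\<lambda>x. f x - g x) \<in> L2_space \<mu>"
  using L2_space_lin[of f \<mu> g 1 "-1"] by simp

lemma L2_space_indicator:
  fixes f :: "'a \<Rightarrow> complex"
  assumes "A \<in> sets \<mu>" "f \<in> L2_space \<mu>"
  shows "(\<lambda>x. indicator A x * f x) \<in> L2_space \<mu>"
proof -
  have [measurable]: "f \<in> borel_measurable \<mu>" "A \<in> sets \<mu>"
    using assms by (auto simp: L2_space_def)
  have "integrable \<mu> (\<lambda>x. (norm (f x))\<^sup>2)"
    using assms by (auto simp: L2_space_def)
  then have "integrable \<mu> (\<lambda>x. (norm (indicator A x * f x))\<^sup>2)"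
    by (rule Bochner_Integration.integrable_bound) (auto simp: indicator_def)
  then show ?thesis by (simp add: L2_space_def)
qed

section \<open>Norm and inner product up to null sets\<close>

lemma L2_norm_nonneg: "0 \<le> L2_norm \<mu> f"
  by (simp add: L2_norm_def)

lemma L2_norm_sq: "(L2_norm \<mu> f)\<^sup>2 = (\<integral>x. (norm (f x))\<^sup>2 \<partial>\<mu>)"
  by (simp add: L2_norm_def)

lemma L2_norm_cong_AE:
  assumes "f \<in> L2_space \<mu>" "g \<in> L2_space \<mu>" "AE x in \<mu>. f x = g x"
  shows "L2_norm \<mu> f = L2_norm \<mu> g"
  unfolding L2_norm_def
  using assms by (intro arg_cong[of _ _ sqrt] integral_cong_AE) (auto simp: L2_space_def)

lemma L2_measurable_mult_cnj:
  assumes "f \<in> L2_space \<mu>" "g \<in> L2_space \<mu>"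
  shows "(\<lambda>x. f x * cnj (g x)) \<in> borel_measurable \<mu>"
proof -
  have [measurable]: "f \<in> borel_measurable \<mu>" "g \<in> borel_measurable \<mu>"
    using assms by (auto simp: L2_space_def)
  have [measurable]: "cnj \<in> borel_measurable borel"
    by (intro borel_measurable_continuous_onI continuous_intros)
  show ?thesis by measurable
qed

lemma L2_inner_cong_AE:
  assumes "f \<in> L2_space \<mu>" "f' \<in> L2_space \<mu>" "AE x in \<mu>. f x = f' x"
    and "g \<in> L2_space \<mu>" "g' \<in> L2_space \<mu>" "AE x in \<mu>. g x = g' x"
  shows "L2_inner \<mu> f g = L2_inner \<mu> f' g'"
  unfolding L2_inner_def
  using assms by (intro integral_cong_AE L2_measurable_mult_cnj) auto

lemma L2_norm_zero_AE:
  assumes "AE x in \<mu>. f x = 0"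
  shows "L2_norm \<mu> f = 0"
proof -
  have "AE x in \<mu>. (norm (f x))\<^sup>2 = 0" using assms by eventually_elim simp
  then show ?thesis by (simp add: L2_norm_def integral_eq_zero_AE)
qed

lemma L2_norm_eq_0_AE:
  assumes "f \<in> L2_space \<mu>" "L2_norm \<mu> f = 0"
  shows "AE x in \<mu>. f x = 0"
proof -
  have "(\<integral>x. (norm (f x))\<^sup>2 \<partial>\<mu>) = 0"
    using assms(2) by (metis L2_norm_sq zero_power2)
  then have "AE x in \<mu>. (norm (f x))\<^sup>2 = 0"
    using assms(1) by (subst (asm) integral_nonneg_eq_0_iff_AE) (auto simp: L2_space_def)
  then show ?thesis by simp
qed

lemma L2_inner_self: "L2_inner \<mu> f f = complex_of_real ((L2_norm \<mu> f)\<^sup>2)"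
  by (simp add: L2_inner_def L2_norm_sq complex_norm_square[symmetric] del: of_real_power)

section \<open>Cauchy-Schwarz, triangle inequality and Pythagoras\<close>

text \<open>The weight is left free: \<open>c = 1\<close> gives integrability of products, the
  optimal \<open>c\<close> gives Cauchy-Schwarz.\<close>

lemma young_weighted:
  fixes u v c :: real
  assumes "c > 0"
  shows "u * v \<le> (c * u\<^sup>2 + v\<^sup>2 / c) / 2"
proof -
  have "0 \<le> (c * u - v)\<^sup>2 / c" using assms by simp
  also have "\<dots> = c * u\<^sup>2 - 2 * (u * v) + v\<^sup>2 / c"
    using assms by (simp add: power2_eq_square field_simps)
  finally show ?thesis by simp
qed

lemma L2_integrable_mult:
  assumes "f \<in> L2_space \<mu>" "g \<in> L2_space \<mu>"
  shows "integrable \<mu> (\<lambda>x. f x * cnj (g x))" "integrable \<mu> (\<lambda>x. norm (f x) * norm (g x))"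
proof -
  have [measurable]: "f \<in> borel_measurable \<mu>" "g \<in> borel_measurable \<mu>"
    using assms by (auto simp: L2_space_def)
  \<comment> \<open>The factor and the divisor 1 keep the shape of \<open>young_weighted\<close> at
    \<open>c = 1\<close>, which supplies the domination.\<close>
  have i: "integrable \<mu> (\<lambda>x. (1 * (norm (f x))\<^sup>2 + (norm (g x))\<^sup>2 / 1) / 2)"
    using assms by (auto simp: L2_space_def)
  show "integrable \<mu> (\<lambda>x. norm (f x) * norm (g x))"
    by (rule Bochner_Integration.integrable_bound[OF i])
      (use young_weighted[of 1] in \<open>auto simp: abs_mult\<close>)
  show "integrable \<mu> (\<lambda>x. f x * cnj (g x))"
    by (intro Bochner_Integration.integrable_bound[OF i])
      (use young_weighted[of 1] L2_measurable_mult_cnj[OF assms] in \<open>auto simp: norm_mult\<close>)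
qed

lemma L2_inner_add_left:
  assumes "f \<in> L2_space \<mu>" "g \<in> L2_space \<mu>" "h \<in> L2_space \<mu>"
  shows "L2_inner \<mu> (\<lambda>x. f x + g x) h = L2_inner \<mu> f h + L2_inner \<mu> g h"
  using assms by (simp add: L2_inner_def distrib_right L2_integrable_mult)

text \<open>Integrate the weighted Young inequality and minimise over the weight. The bound on the
  integral of absolute values implies the first claim and also serves the triangle
  inequality.\<close>

lemma L2_cauchy_schwarz:
  assumes f: "f \<in> L2_space \<mu>" and g: "g \<in> L2_space \<mu>"
  shows "norm (L2_inner \<mu> f g) \<le> L2_norm \<mu> f * L2_norm \<mu> g"
    and "(\<integral>x. norm (f x) * norm (g x) \<partial>\<mu>) \<le> L2_norm \<mu> f * L2_norm \<mu> g"
proof -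
  let ?I = "\<integral>x. norm (f x) * norm (g x) \<partial>\<mu>"
  show le: "?I \<le> L2_norm \<mu> f * L2_norm \<mu> g"
  proof (cases "L2_norm \<mu> f = 0 \<or> L2_norm \<mu> g = 0")
    case True
    then have "AE x in \<mu>. norm (f x) * norm (g x) = 0"
      using L2_norm_eq_0_AE[OF f] L2_norm_eq_0_AE[OF g] by auto
    then have "?I = 0" by (rule integral_eq_zero_AE)
    then show ?thesis using True by auto
  next
    case False
    then have pos: "L2_norm \<mu> f > 0" "L2_norm \<mu> g > 0"
      using L2_norm_nonneg[of \<mu> f] L2_norm_nonneg[of \<mu> g] by auto
    \<comment> \<open>This weight minimises the integrated Young bound: both of its terms become
      \<parallel>f\<parallel> \<parallel>g\<parallel>. It is positive because neither norm
      vanishes.\<close>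
    define c where "c = L2_norm \<mu> g / L2_norm \<mu> f"
    have c: "c > 0" using pos by (simp add: c_def)
    have int: "integrable \<mu> (\<lambda>x. (norm (f x))\<^sup>2)" "integrable \<mu> (\<lambda>x. (norm (g x))\<^sup>2)"
      using f g by (auto simp: L2_space_def)
    have "?I \<le> (\<integral>x. (c * (norm (f x))\<^sup>2 + (norm (g x))\<^sup>2 / c) / 2 \<partial>\<mu>)"
      using int by (intro integral_mono L2_integrable_mult f g young_weighted c) auto
    also have "\<dots> = (c * (L2_norm \<mu> f)\<^sup>2 + (L2_norm \<mu> g)\<^sup>2 / c) / 2"
      using int by (simp add: L2_norm_sq)
    also have "\<dots> = L2_norm \<mu> f * L2_norm \<mu> g"
      using pos by (simp add: c_def power2_eq_square field_simps)
    finally show ?thesis .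
  qed
  have "norm (L2_inner \<mu> f g) \<le> (\<integral>x. norm (f x * cnj (g x)) \<partial>\<mu>)"
    unfolding L2_inner_def by (rule integral_norm_bound)
  then show "norm (L2_inner \<mu> f g) \<le> L2_norm \<mu> f * L2_norm \<mu> g"
    using le by (simp add: norm_mult)
qed

lemma L2_norm_triangle:
  assumes f: "f \<in> L2_space \<mu>" and g: "g \<in> L2_space \<mu>"
  shows "L2_norm \<mu> (\<lambda>x. f x + g x) \<le> L2_norm \<mu> f + L2_norm \<mu> g"
proof (rule power2_le_imp_le)
  have int: "integrable \<mu> (\<lambda>x. (norm (f x))\<^sup>2)" "integrable \<mu> (\<lambda>x. (norm (g x))\<^sup>2)"
    using f g by (auto simp: L2_space_def)
  note int = int L2_integrable_mult(2)[OF f g]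
  have "(L2_norm \<mu> (\<lambda>x. f x + g x))\<^sup>2
      \<le> (\<integral>x. (norm (f x))\<^sup>2 + (norm (g x))\<^sup>2 + 2 * (norm (f x) * norm (g x)) \<partial>\<mu>)"
    unfolding L2_norm_sq
  proof (rule integral_mono)
    show "integrable \<mu> (\<lambda>x. (norm (f x + g x))\<^sup>2)"
      using L2_space_add[OF f g] by (simp add: L2_space_def)
    show "integrable \<mu> (\<lambda>x. (norm (f x))\<^sup>2 + (norm (g x))\<^sup>2 + 2 * (norm (f x) * norm (g x)))"
      using int by auto
    show "(norm (f x + g x))\<^sup>2 \<le> (norm (f x))\<^sup>2 + (norm (g x))\<^sup>2 + 2 * (norm (f x) * norm (g x))"
      for x
      using power_mono[OF norm_triangle_ineq[of "f x" "g x"], of 2] by (simp add: power2_sum)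
  qed
  also have "\<dots> = (L2_norm \<mu> f)\<^sup>2 + (L2_norm \<mu> g)\<^sup>2 + 2 * (\<integral>x. norm (f x) * norm (g x) \<partial>\<mu>)"
    using int by (simp add: L2_norm_sq)
  also have "\<dots> \<le> (L2_norm \<mu> f + L2_norm \<mu> g)\<^sup>2"
    using L2_cauchy_schwarz(2)[OF f g] by (simp add: power2_sum)
  finally show "(L2_norm \<mu> (\<lambda>x. f x + g x))\<^sup>2 \<le> (L2_norm \<mu> f + L2_norm \<mu> g)\<^sup>2" .
qed (simp add: L2_norm_nonneg)

text \<open>At each point one summand vanishes, so the squared modulus splits without a cross
  term.\<close>

lemma L2_norm_pythagoras:
  assumes "f \<in> L2_space \<mu>" "g \<in> L2_space \<mu>" "\<And>x. f x = 0 \<or> g x = 0"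
  shows "(L2_norm \<mu> (\<lambda>x. f x + g x))\<^sup>2 = (L2_norm \<mu> f)\<^sup>2 + (L2_norm \<mu> g)\<^sup>2"
proof -
  have "(norm (f x + g x))\<^sup>2 = (norm (f x))\<^sup>2 + (norm (g x))\<^sup>2" for x
    using assms(3)[of x] by auto
  then show ?thesis using assms by (simp add: L2_norm_sq L2_space_def)
qed

lemma L2_norm_indicator_le:
  fixes f :: "'a \<Rightarrow> complex"
  assumes "A \<in> sets \<mu>" "f \<in> L2_space \<mu>"
  shows "L2_norm \<mu> (\<lambda>x. indicator A x * f x) \<le> L2_norm \<mu> f"
  unfolding L2_norm_def
  using L2_space_indicator[OF assms] assms
  by (intro real_sqrt_le_mono integral_mono) (auto simp: L2_space_def indicator_def)

section \<open>The projections\<close>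

lemma L2_unitary_norm:
  assumes "L2_unitary \<mu> U" "f \<in> L2_space \<mu>"
  shows "L2_norm \<mu> (U f) = L2_norm \<mu> f"
proof -
  have "complex_of_real ((L2_norm \<mu> (U f))\<^sup>2) = complex_of_real ((L2_norm \<mu> f)\<^sup>2)"
    using assms unfolding L2_inner_self[symmetric] by (simp add: L2_unitary_def)
  then have "(L2_norm \<mu> (U f))\<^sup>2 = (L2_norm \<mu> f)\<^sup>2"
    by (simp only: of_real_eq_iff)
  then show ?thesis by (simp add: L2_norm_nonneg)
qed

lemma L2_unitary_lin:
  assumes "L2_unitary \<mu> U" "f \<in> L2_space \<mu>" "g \<in> L2_space \<mu>"
  shows "AE x in \<mu>. U (\<lambda>y. \<alpha> * f y + \<beta> * g y) x = \<alpha> * U f x + \<beta> * U g x"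
  using assms by (simp add: L2_unitary_def L2_linear_def)

lemma L2_unitary_closed:
  "L2_unitary \<mu> U \<Longrightarrow> f \<in> L2_space \<mu> \<Longrightarrow> U f \<in> L2_space \<mu>"
  by (simp add: L2_unitary_def L2_linear_def)

text \<open>The difference has image 0 almost everywhere, and an isometry preserves its norm. This
  reduces identities between values of \<open>F_op\<close> to identities between their
  transforms.\<close>

lemma L2_unitary_inject_AE:
  assumes U: "L2_unitary \<mu> U" and f: "f \<in> L2_space \<mu>" and g: "g \<in> L2_space \<mu>"
    and eq: "AE x in \<mu>. U f x = U g x"
  shows "AE x in \<mu>. f x = g x"
proof -
  \<comment> \<open>Linearity is stated for \<open>\<alpha> * f y + \<beta> * g y\<close>, so the
    difference is written in that form.\<close>
  let ?d = "\<lambda>x. 1 * f x + (-1) * g x"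
  have d: "?d \<in> L2_space \<mu>" by (rule L2_space_lin[OF f g])
  have "AE x in \<mu>. U ?d x = 0"
    using L2_unitary_lin[OF U f g, of 1 "-1"] eq by eventually_elim simp
  then have "L2_norm \<mu> (U ?d) = 0" by (rule L2_norm_zero_AE)
  then have "AE x in \<mu>. ?d x = 0"
    using L2_norm_eq_0_AE[OF d] L2_unitary_norm[OF U d] by simp
  then show ?thesis by eventually_elim simp
qed

text \<open>\<open>U\<close> acts on representatives, so compatibility with null sets has to be
  derived: the difference has norm 0, hence so does its image.\<close>

lemma L2_unitary_cong_AE:
  assumes U: "L2_unitary \<mu> U" and f: "f \<in> L2_space \<mu>" and g: "g \<in> L2_space \<mu>"
    and eq: "AE x in \<mu>. f x = g x"
  shows "AE x in \<mu>. U f x = U g x"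
proof -
  let ?d = "\<lambda>x. 1 * f x + (-1) * g x"
  have d: "?d \<in> L2_space \<mu>" by (rule L2_space_lin[OF f g])
  have "AE x in \<mu>. ?d x = 0" using eq by eventually_elim simp
  then have "L2_norm \<mu> (U ?d) = 0"
    unfolding L2_unitary_norm[OF U d] by (rule L2_norm_zero_AE)
  then have "AE x in \<mu>. U ?d x = 0"
    by (rule L2_norm_eq_0_AE[OF L2_unitary_closed[OF U d]])
  then show ?thesis
    using L2_unitary_lin[OF U f g, of 1 "-1"] by eventually_elim simp
qed

section \<open>Cutoffs in space and on the transform side\<close>

lemma E_op_closed: "A \<in> sets \<mu> \<Longrightarrow> f \<in> L2_space \<mu> \<Longrightarrow> E_op A f \<in> L2_space \<mu>"
  unfolding E_op_def by (rule L2_space_indicator)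

lemma E_op_norm_le: "A \<in> sets \<mu> \<Longrightarrow> f \<in> L2_space \<mu> \<Longrightarrow> L2_norm \<mu> (E_op A f) \<le> L2_norm \<mu> f"
  unfolding E_op_def by (rule L2_norm_indicator_le)

lemma E_op_lin: "E_op A (\<lambda>y. \<alpha> * f y + \<beta> * g y) = (\<lambda>x. \<alpha> * E_op A f x + \<beta> * E_op A g x)"
  by (auto simp: E_op_def algebra_simps)

text \<open>Surjectivity of \<open>U\<close> provides a preimage for the choice in
  \<open>L2_inv\<close>. Later arguments use \<open>F_op\<close> only through these two facts; the
  chosen representative stays unknown.\<close>

lemma F_op_closed_and_transform:
  assumes "L2_unitary \<mu> U" "A \<in> sets \<mu>" "f \<in> L2_space \<mu>"
  shows "F_op \<mu> U A f \<in> L2_space \<mu> \<and> (AE x in \<mu>. U (F_op \<mu> U A f) x = indicator A x * U f x)"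
proof -
  have "(\<lambda>\<xi>. indicator A \<xi> * U f \<xi>) \<in> L2_space \<mu>"
    by (intro L2_space_indicator L2_unitary_closed[OF assms(1)] assms(2,3))
  then have "\<exists>h. h \<in> L2_space \<mu> \<and> (AE x in \<mu>. U h x = indicator A x * U f x)"
    using assms(1) by (auto simp: L2_unitary_def)
  then show ?thesis
    unfolding F_op_def L2_inv_def by (rule someI_ex)
qed

lemmas F_op_closed = F_op_closed_and_transform[THEN conjunct1]
lemmas F_op_transform = F_op_closed_and_transform[THEN conjunct2]

text \<open>Under the isometry \<open>U\<close>, \<open>F_op\<close> becomes multiplication by an
  indicator, which does not increase the norm.\<close>

lemma F_op_norm_le:
  assumes "L2_unitary \<mu> U" "A \<in> sets \<mu>" "f \<in> L2_space \<mu>"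
  shows "L2_norm \<mu> (F_op \<mu> U A f) \<le> L2_norm \<mu> f"
proof -
  have "L2_norm \<mu> (F_op \<mu> U A f) = L2_norm \<mu> (\<lambda>x. indicator A x * U f x)"
    by (rule trans[OF L2_unitary_norm[OF assms(1) F_op_closed[OF assms], symmetric]
          L2_norm_cong_AE[OF L2_unitary_closed[OF assms(1) F_op_closed[OF assms]]
            L2_space_indicator[OF assms(2) L2_unitary_closed[OF assms(1,3)]] F_op_transform[OF assms]]])
  also have "\<dots> \<le> L2_norm \<mu> (U f)"
    by (intro L2_norm_indicator_le L2_unitary_closed[OF assms(1)] assms(2,3))
  finally show ?thesis using L2_unitary_norm[OF assms(1,3)] by simp
qed

text \<open>Preimages are chosen separately for each argument, so linearity is claimed almost
  everywhere: both sides have the same transform, and \<open>U\<close> is injective up to null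
  sets.\<close>

lemma F_op_lin:
  assumes U: "L2_unitary \<mu> U" and A: "A \<in> sets \<mu>" and f: "f \<in> L2_space \<mu>" and g: "g \<in> L2_space \<mu>"
  shows "AE x in \<mu>. F_op \<mu> U A (\<lambda>y. \<alpha> * f y + \<beta> * g y) x
    = \<alpha> * F_op \<mu> U A f x + \<beta> * F_op \<mu> U A g x"
proof (rule L2_unitary_inject_AE[OF U])
  note fg = L2_space_lin[OF f g, of \<alpha> \<beta>]
  note Ff = F_op_closed[OF U A f] and Fg = F_op_closed[OF U A g]
  show "F_op \<mu> U A (\<lambda>y. \<alpha> * f y + \<beta> * g y) \<in> L2_space \<mu>" by (rule F_op_closed[OF U A fg])
  show "(\<lambda>x. \<alpha> * F_op \<mu> U A f x + \<beta> * F_op \<mu> U A g x) \<in> L2_space \<mu>"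
    by (rule L2_space_lin[OF Ff Fg])
  show "AE x in \<mu>. U (F_op \<mu> U A (\<lambda>y. \<alpha> * f y + \<beta> * g y)) x
      = U (\<lambda>x. \<alpha> * F_op \<mu> U A f x + \<beta> * F_op \<mu> U A g x) x"
    using F_op_transform[OF U A fg] L2_unitary_lin[OF U f g, of \<alpha> \<beta>]
      L2_unitary_lin[OF U Ff Fg, of \<alpha> \<beta>] F_op_transform[OF U A f] F_op_transform[OF U A g]
    by eventually_elim (simp add: algebra_simps)
qed

lemma F_op_cong_AE:
  assumes U: "L2_unitary \<mu> U" and A: "A \<in> sets \<mu>" and f: "f \<in> L2_space \<mu>" and g: "g \<in> L2_space \<mu>"
    and eq: "AE x in \<mu>. f x = g x"
  shows "AE x in \<mu>. F_op \<mu> U A f x = F_op \<mu> U A g x"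
proof (rule L2_unitary_inject_AE[OF U F_op_closed[OF U A f] F_op_closed[OF U A g]])
  show "AE x in \<mu>. U (F_op \<mu> U A f) x = U (F_op \<mu> U A g) x"
    using F_op_transform[OF U A f] F_op_transform[OF U A g] L2_unitary_cong_AE[OF U f g eq]
    by eventually_elim simp
qed

text \<open>On the transform side the two indicators add up to 1 on
  \<open>space \<mu>\<close>.\<close>

lemma F_op_complement:
  assumes U: "L2_unitary \<mu> U" and A: "A \<in> sets \<mu>" and f: "f \<in> L2_space \<mu>"
  shows "AE x in \<mu>. f x = F_op \<mu> U A f x + F_op \<mu> U (space \<mu> - A) f x"
proof (rule L2_unitary_inject_AE[OF U f])
  have A': "space \<mu> - A \<in> sets \<mu>" using A by auto
  note Ff = F_op_closed[OF U A f] and Gf = F_op_closed[OF U A' f]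
  show "(\<lambda>x. F_op \<mu> U A f x + F_op \<mu> U (space \<mu> - A) f x) \<in> L2_space \<mu>"
    by (rule L2_space_add[OF Ff Gf])
  show "AE x in \<mu>. U f x = U (\<lambda>x. F_op \<mu> U A f x + F_op \<mu> U (space \<mu> - A) f x) x"
    using L2_unitary_lin[OF U Ff Gf, of 1 1] F_op_transform[OF U A f] F_op_transform[OF U A' f]
      AE_space
    by eventually_elim (auto simp: indicator_def)
qed

text \<open>The mark of an orthogonal projection: on the transform side it says that an indicator is
  real and equal to its square.\<close>

lemma F_op_inner_self:
  assumes U: "L2_unitary \<mu> U" and A: "A \<in> sets \<mu>" and f: "f \<in> L2_space \<mu>"
  shows "L2_inner \<mu> (F_op \<mu> U A f) f = complex_of_real ((L2_norm \<mu> (F_op \<mu> U A f))\<^sup>2)"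
proof -
  let ?F = "F_op \<mu> U A f" and ?h = "\<lambda>x. indicator A x * U f x"
  note F = F_op_closed[OF U A f]
  note UF = L2_unitary_closed[OF U F] and Uf = L2_unitary_closed[OF U f]
  note h = L2_space_indicator[OF A Uf]
  have "L2_inner \<mu> ?F f = L2_inner \<mu> (U ?F) (U f)"
    using U F f by (simp add: L2_unitary_def)
  also have "\<dots> = L2_inner \<mu> ?h (U f)"
    by (rule L2_inner_cong_AE[OF UF h F_op_transform[OF U A f] Uf Uf]) simp
  also have "\<dots> = L2_inner \<mu> ?h ?h"
    unfolding L2_inner_def by (rule Bochner_Integration.integral_cong) (auto simp: indicator_def)
  also have "\<dots> = complex_of_real ((L2_norm \<mu> (U ?F))\<^sup>2)"
    unfolding L2_inner_self using L2_norm_cong_AE[OF UF h F_op_transform[OF U A f]] by simp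
  also have "\<dots> = complex_of_real ((L2_norm \<mu> ?F)\<^sup>2)"
    using L2_unitary_norm[OF U F] by simp
  finally show ?thesis .
qed

section \<open>Boundedness of the composed operators\<close>

text \<open>\<open>localized\<close> asks for a bounded operator. Both factors are contractions, so
  the constant 1 works.\<close>

lemma L2_bounded_F_E:
  assumes U: "L2_unitary \<mu> U" and S: "S \<in> sets \<mu>" and A: "A \<in> sets \<mu>"
  shows "L2_bounded \<mu> (\<lambda>g. F_op \<mu> U A (E_op S g))"
  unfolding L2_bounded_def L2_linear_def
proof (intro conjI ballI allI)
  fix f g assume f: "f \<in> L2_space \<mu>" and g: "g \<in> L2_space \<mu>"
  show "F_op \<mu> U A (E_op S f) \<in> L2_space \<mu>"
    by (intro F_op_closed[OF U A] E_op_closed S f)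
  fix \<alpha> \<beta> show "AE x in \<mu>. F_op \<mu> U A (E_op S (\<lambda>y. \<alpha> * f y + \<beta> * g y)) x =
      \<alpha> * F_op \<mu> U A (E_op S f) x + \<beta> * F_op \<mu> U A (E_op S g) x"
    unfolding E_op_lin by (rule F_op_lin[OF U A E_op_closed[OF S f] E_op_closed[OF S g]])
next
  show "\<exists>C. \<forall>f\<in>L2_space \<mu>. L2_norm \<mu> (F_op \<mu> U A (E_op S f)) \<le> C * L2_norm \<mu> f"
    using F_op_norm_le[OF U A E_op_closed[OF S]] E_op_norm_le[OF S]
    by (intro exI[of _ 1]) (fastforce intro: order_trans)
qed

text \<open>The outer cutoff is linear pointwise and a contraction, so the inner bound carries over
  with the same constant.\<close>

lemma L2_bounded_L_op:
  assumes U: "L2_unitary \<mu> U" and S: "S \<in> sets \<mu>" and A: "A \<in> sets \<mu>"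
  shows "L2_bounded \<mu> (L_op \<mu> U S A)"
proof -
  note FE = L2_bounded_F_E[OF U S A, unfolded L2_bounded_def L2_linear_def]
  have closed: "F_op \<mu> U A (E_op S f) \<in> L2_space \<mu>" if "f \<in> L2_space \<mu>" for f
    using FE that by blast
  obtain C where C: "\<And>f. f \<in> L2_space \<mu> \<Longrightarrow> L2_norm \<mu> (F_op \<mu> U A (E_op S f)) \<le> C * L2_norm \<mu> f"
    using FE by blast
  show ?thesis
    unfolding L2_bounded_def L2_linear_def
  proof (intro conjI ballI allI)
    fix f g assume f: "f \<in> L2_space \<mu>" and g: "g \<in> L2_space \<mu>"
    show "L_op \<mu> U S A f \<in> L2_space \<mu>"
      unfolding L_op_def by (intro E_op_closed S closed f)
    fix \<alpha> \<beta>
    have "AE x in \<mu>. F_op \<mu> U A (E_op S (\<lambda>y. \<alpha> * f y + \<beta> * g y)) x =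
        \<alpha> * F_op \<mu> U A (E_op S f) x + \<beta> * F_op \<mu> U A (E_op S g) x"
      using FE f g by blast
    then show "AE x in \<mu>. L_op \<mu> U S A (\<lambda>y. \<alpha> * f y + \<beta> * g y) x =
        \<alpha> * L_op \<mu> U S A f x + \<beta> * L_op \<mu> U S A g x"
      unfolding L_op_def E_op_def[of S "F_op \<mu> U A _"]
      by eventually_elim (simp add: algebra_simps)
  next
    show "\<exists>C. \<forall>f\<in>L2_space \<mu>. L2_norm \<mu> (L_op \<mu> U S A f) \<le> C * L2_norm \<mu> f"
      unfolding L_op_def
      using E_op_norm_le[OF S closed] C by (intro exI[of _ C]) (blast intro: order_trans)
  qed
qed

section \<open>The defect of the localization operator\<close>

text \<open>The defect is \<open>c + E_op S G\<close> almost everywhere, with disjoint supports. The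
  first claim evaluates the quadratic form exactly; the other two bound the norm by Pythagoras and
  by the triangle inequality, using that \<open>E_op S\<close> is a contraction.\<close>

lemma L_op_defect:
  assumes U: "L2_unitary \<mu> U" and S: "S \<in> sets \<mu>" and A: "A \<in> sets \<mu>" and f: "f \<in> L2_space \<mu>"
  defines "c \<equiv> E_op (space \<mu> - S) f" and "G \<equiv> F_op \<mu> U (space \<mu> - A) (E_op S f)"
  shows "L2_inner \<mu> (\<lambda>x. f x - L_op \<mu> U S A f x) f
      = complex_of_real ((L2_norm \<mu> c)\<^sup>2 + (L2_norm \<mu> G)\<^sup>2)"
    and "(L2_norm \<mu> (\<lambda>x. f x - L_op \<mu> U S A f x))\<^sup>2 \<le> (L2_norm \<mu> c)\<^sup>2 + (L2_norm \<mu> G)\<^sup>2"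
    and "L2_norm \<mu> (\<lambda>x. f x - L_op \<mu> U S A f x) \<le> L2_norm \<mu> c + L2_norm \<mu> G"
proof -
  let ?D = "\<lambda>x. f x - L_op \<mu> U S A f x"
  have S': "space \<mu> - S \<in> sets \<mu>" and A': "space \<mu> - A \<in> sets \<mu>" using S A by auto
  note e = E_op_closed[OF S f]
  have c: "c \<in> L2_space \<mu>" unfolding c_def by (rule E_op_closed[OF S' f])
  have G: "G \<in> L2_space \<mu>" unfolding G_def by (rule F_op_closed[OF U A' e])
  note EG = E_op_closed[OF S G]
  have D: "?D \<in> L2_space \<mu>"
    unfolding L_op_def by (intro L2_space_diff f E_op_closed S F_op_closed[OF U A] e)
  note cEG = L2_space_add[OF c EG]
  \<comment> \<open>Off \<open>S\<close> only \<open>c = f\<close> survives. On \<open>S\<close>,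
    \<open>E_op S f = f\<close> splits into its projections for \<open>A\<close> and the complement;
    subtracting the first leaves \<open>G\<close>.\<close>
  have D_eq: "AE x in \<mu>. ?D x = c x + E_op S G x"
    using F_op_complement[OF U A e] AE_space
  proof eventually_elim
    case (elim x)
    then show ?case
      by (cases "x \<in> S") (auto simp: c_def G_def L_op_def E_op_def)
  qed
  have norm_D: "L2_norm \<mu> ?D = L2_norm \<mu> (\<lambda>x. c x + E_op S G x)"
    by (rule L2_norm_cong_AE[OF D cEG D_eq])
  have disj: "c x = 0 \<or> E_op S G x = 0" for x
    by (auto simp: c_def E_op_def indicator_def)
  have le: "L2_norm \<mu> (E_op S G) \<le> L2_norm \<mu> G" by (rule E_op_norm_le[OF S G])
  show "(L2_norm \<mu> ?D)\<^sup>2 \<le> (L2_norm \<mu> c)\<^sup>2 + (L2_norm \<mu> G)\<^sup>2"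
    unfolding norm_D L2_norm_pythagoras[OF c EG disj]
    using power_mono[OF le L2_norm_nonneg] by simp
  show "L2_norm \<mu> ?D \<le> L2_norm \<mu> c + L2_norm \<mu> G"
    using L2_norm_triangle[OF c EG] le unfolding norm_D by linarith
  have "L2_inner \<mu> ?D f = L2_inner \<mu> (\<lambda>x. c x + E_op S G x) f"
    by (rule L2_inner_cong_AE[OF D cEG D_eq f f]) simp
  also have "\<dots> = L2_inner \<mu> c f + L2_inner \<mu> (E_op S G) f"
    by (rule L2_inner_add_left[OF c EG f])
  also have "L2_inner \<mu> c f = L2_inner \<mu> c c"
    unfolding L2_inner_def
    by (rule Bochner_Integration.integral_cong) (auto simp: c_def E_op_def indicator_def)
  \<comment> \<open>The real cutoff moves to the other argument, which pairs \<open>G\<close> with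
    the very function it is a projection of.\<close>
  also have "L2_inner \<mu> (E_op S G) f = L2_inner \<mu> G (E_op S f)"
    unfolding L2_inner_def
    by (rule Bochner_Integration.integral_cong) (auto simp: E_op_def indicator_def)
  also have "\<dots> = complex_of_real ((L2_norm \<mu> G)\<^sup>2)"
    unfolding G_def by (rule F_op_inner_self[OF U A' e])
  finally show "L2_inner \<mu> ?D f = complex_of_real ((L2_norm \<mu> c)\<^sup>2 + (L2_norm \<mu> G)\<^sup>2)"
    by (simp add: L2_inner_self)
qed

text \<open>\<open>localized\<close> measures \<open>L f - f\<close>, whereas the defect is
  \<open>f - L f\<close>.\<close>

lemma L2_norm_minus_commute: "L2_norm \<mu> (\<lambda>x. f x - g x) = L2_norm \<mu> (\<lambda>x. g x - f x)"
  by (simp add: L2_norm_def norm_minus_commute)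

section \<open>Error bounds for concentrated functions\<close>

text \<open>Replacing \<open>f\<close> by \<open>E_op S f\<close> costs at most \<epsilon>1
  \<parallel>f\<parallel>, and the contractions do not enlarge this error. The part of
  \<open>f\<close> with transform off \<open>A\<close> adds at most \<epsilon>2
  \<parallel>f\<parallel>.\<close>

lemma concentrated_bounds:
  assumes U: "L2_unitary \<mu> U" and S: "S \<in> sets \<mu>" and A: "A \<in> sets \<mu>"
    and conc: "f \<in> L2_concentrated \<mu> U \<epsilon>1 \<epsilon>2 S A"
  shows "L2_norm \<mu> (F_op \<mu> U (space \<mu> - A) (E_op S f)) \<le> (\<epsilon>1 + \<epsilon>2) * L2_norm \<mu> f"
    and "L2_norm \<mu> (\<lambda>x. F_op \<mu> U A (E_op S f) x - f x) \<le> (\<epsilon>1 + \<epsilon>2) * L2_norm \<mu> f"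
proof -
  let ?c = "E_op (space \<mu> - S) f" and ?F = "F_op \<mu> U A" and ?G = "F_op \<mu> U (space \<mu> - A)"
  have S': "space \<mu> - S \<in> sets \<mu>" and A': "space \<mu> - A \<in> sets \<mu>" using S A by auto
  have f: "f \<in> L2_space \<mu>" and c_le: "L2_norm \<mu> ?c \<le> \<epsilon>1 * L2_norm \<mu> f"
    and G_le: "L2_norm \<mu> (?G f) \<le> \<epsilon>2 * L2_norm \<mu> f"
    using conc by (auto simp: L2_concentrated_def L2_nonzero_def)
  note e = E_op_closed[OF S f] and c = E_op_closed[OF S' f]
  have c_eq: "AE x in \<mu>. ?c x = 1 * f x + (-1) * E_op S f x"
    using AE_space by eventually_elim (auto simp: E_op_def indicator_def)
  \<comment> \<open>The set \<open>B\<close> is arbitrary because both \<open>A\<close> and its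
    complement are needed below.\<close>
  have split: "AE x in \<mu>. F_op \<mu> U B ?c x = F_op \<mu> U B f x - F_op \<mu> U B (E_op S f) x"
    if B: "B \<in> sets \<mu>" for B
  proof -
    let ?e' = "\<lambda>x. 1 * ?c x + (1::complex) * E_op S f x"
    have e': "?e' \<in> L2_space \<mu>" by (rule L2_space_lin[OF c e])
    have "AE x in \<mu>. F_op \<mu> U B ?e' x = 1 * F_op \<mu> U B ?c x + 1 * F_op \<mu> U B (E_op S f) x"
      by (rule F_op_lin[OF U B c e])
    \<comment> \<open>Outside \<open>space \<mu>\<close> both cutoffs vanish, so \<open>f\<close>
      and the sum are only known to agree almost everywhere.\<close>
    moreover have "AE x in \<mu>. F_op \<mu> U B f x = F_op \<mu> U B ?e' x"
      using c_eq by (intro F_op_cong_AE[OF U B f e'], eventually_elim) simp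
    ultimately show ?thesis by eventually_elim simp
  qed
  note Gf = F_op_closed[OF U A' f] and Ge = F_op_closed[OF U A' e] and Gc = F_op_closed[OF U A' c]
  note Ff = F_op_closed[OF U A f] and Fe = F_op_closed[OF U A e] and Fc = F_op_closed[OF U A c]
  have "L2_norm \<mu> (?G (E_op S f)) = L2_norm \<mu> (\<lambda>x. ?G f x - ?G ?c x)"
    using split[OF A'] by (intro L2_norm_cong_AE Ge L2_space_diff Gf Gc) auto
  also have "\<dots> \<le> L2_norm \<mu> (?G f) + L2_norm \<mu> (\<lambda>x. - ?G ?c x)"
    using L2_norm_triangle[OF Gf, of "\<lambda>x. - ?G ?c x"] L2_space_lin[OF Gc Gc, of "-1" 0] by simp
  also have "L2_norm \<mu> (\<lambda>x. - ?G ?c x) = L2_norm \<mu> (?G ?c)" by (simp add: L2_norm_def)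
  finally show "L2_norm \<mu> (?G (E_op S f)) \<le> (\<epsilon>1 + \<epsilon>2) * L2_norm \<mu> f"
    using F_op_norm_le[OF U A' c] c_le G_le by (simp add: distrib_right)
  \<comment> \<open>Combine \<open>f = ?F f + ?G f\<close> with
    \<open>?F ?c = ?F f - ?F (E_op S f)\<close>; the term \<open>?F f\<close> cancels.\<close>
  have "AE x in \<mu>. f x - ?F (E_op S f) x = ?G f x + ?F ?c x"
    using split[OF A] F_op_complement[OF U A f] by eventually_elim simp
  then have "L2_norm \<mu> (\<lambda>x. f x - ?F (E_op S f) x) = L2_norm \<mu> (\<lambda>x. ?G f x + ?F ?c x)"
    by (intro L2_norm_cong_AE L2_space_diff L2_space_add f Fe Gf Fc)
  also have "\<dots> \<le> L2_norm \<mu> (?G f) + L2_norm \<mu> (?F ?c)"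
    by (rule L2_norm_triangle[OF Gf Fc])
  finally show "L2_norm \<mu> (\<lambda>x. ?F (E_op S f) x - f x) \<le> (\<epsilon>1 + \<epsilon>2) * L2_norm \<mu> f"
    using F_op_norm_le[OF U A c] c_le G_le
    by (subst L2_norm_minus_commute) (simp add: distrib_right)
qed

section \<open>The four estimates relating concentration and localization\<close>

theorem proposition5p3:
  fixes \<Omega> S \<Sigma> :: "'a::euclidean_space set"
    and \<mu> :: "'a measure"
    and a \<epsilon> \<epsilon>1 \<epsilon>2 :: real
    and Q :: "'a \<Rightarrow> real"
    and \<K> :: "'a \<Rightarrow> 'a \<Rightarrow> complex"
    and \<T> :: "('a \<Rightarrow> complex) \<Rightarrow> 'a \<Rightarrow> complex"
  assumes "integral_operator \<Omega> \<mu> a Q \<K> \<T>"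
    and "S \<in> sets \<mu>" and "0 < emeasure \<mu> S" and "emeasure \<mu> S < \<infinity>"
    and "\<Sigma> \<in> sets \<mu>" and "0 < emeasure \<mu> \<Sigma>" and "emeasure \<mu> \<Sigma> < \<infinity>"
    and "\<epsilon> \<in> {0<..<1}" and "\<epsilon>1 \<in> {0<..<1}" and "\<epsilon>2 \<in> {0<..<1}"
  shows
    "(\<forall>f\<in>L2_concentrated \<mu> \<T> \<epsilon>1 \<epsilon>2 S \<Sigma>.
        localized \<mu> (\<lambda>g. F_op \<mu> \<T> \<Sigma> (E_op S g)) (\<epsilon>1 + \<epsilon>2) f \<and>
        localized \<mu> (L_op \<mu> \<T> S \<Sigma>) (2 * \<epsilon>1 + \<epsilon>2) f) \<and>
     (\<forall>f\<in>L2_space \<mu>. localized \<mu> (L_op \<mu> \<T> S \<Sigma>) \<epsilon> f \<longrightarrow>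
        L2_inner \<mu> (\<lambda>x. f x - L_op \<mu> \<T> S \<Sigma> f x) f
          \<le> complex_of_real ((\<epsilon>\<^sup>2 + \<epsilon>) * (L2_norm \<mu> f)\<^sup>2)) \<and>
     (\<forall>f. L2_nonzero \<mu> f \<and>
        L2_inner \<mu> (\<lambda>x. f x - L_op \<mu> \<T> S \<Sigma> f x) f
          \<le> complex_of_real (\<epsilon> * (L2_norm \<mu> f)\<^sup>2) \<longrightarrow>
        localized \<mu> (L_op \<mu> \<T> S \<Sigma>) (sqrt \<epsilon>) f) \<and>
     (\<forall>f\<in>L2_concentrated \<mu> \<T> \<epsilon>1 \<epsilon>2 S \<Sigma>.
        L2_inner \<mu> (\<lambda>x. f x - L_op \<mu> \<T> S \<Sigma> f x) f
          < complex_of_real ((2 * \<epsilon>1 + \<epsilon>2) * (L2_norm \<mu> f)\<^sup>2))"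
proof -
  have U: "L2_unitary \<mu> \<T>" using assms(1) by (rule integral_operator.unitary)
  have S: "S \<in> sets \<mu>" and A: "\<Sigma> \<in> sets \<mu>" using assms by auto
  have eps: "0 < \<epsilon>" "0 < \<epsilon>1" "\<epsilon>1 < 1" "0 < \<epsilon>2" using assms by auto
  let ?L = "L_op \<mu> \<T> S \<Sigma>"
  let ?c = "E_op (space \<mu> - S)" and ?G = "\<lambda>f. F_op \<mu> \<T> (space \<mu> - \<Sigma>) (E_op S f)"
  note defect = L_op_defect[OF U S A]
  note bds = concentrated_bounds[OF U S A]
  have conc: "L2_nonzero \<mu> f" "f \<in> L2_space \<mu>" "L2_norm \<mu> (?c f) \<le> \<epsilon>1 * L2_norm \<mu> f"
    if "f \<in> L2_concentrated \<mu> \<T> \<epsilon>1 \<epsilon>2 S \<Sigma>" for f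
    using that by (auto simp: L2_concentrated_def L2_nonzero_def)
  have p1: "localized \<mu> (\<lambda>g. F_op \<mu> \<T> \<Sigma> (E_op S g)) (\<epsilon>1 + \<epsilon>2) f \<and> localized \<mu> ?L (2 * \<epsilon>1 + \<epsilon>2) f"
    if f: "f \<in> L2_concentrated \<mu> \<T> \<epsilon>1 \<epsilon>2 S \<Sigma>" for f
  proof -
    \<comment> \<open>One \<open>\<epsilon>1\<close> comes from the part of \<open>f\<close> off
      \<open>S\<close>, the other, together with \<open>\<epsilon>2\<close>, from
      \<open>?G f\<close>.\<close>
    have "L2_norm \<mu> (\<lambda>x. ?L f x - f x) \<le> (2 * \<epsilon>1 + \<epsilon>2) * L2_norm \<mu> f"
      using defect(3)[OF conc(2)[OF f]] conc(3)[OF f] bds(1)[OF f]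
      by (subst L2_norm_minus_commute) (simp add: algebra_simps)
    then show ?thesis
      unfolding localized_def
      using eps conc(1)[OF f] bds(2)[OF f] L2_bounded_F_E[OF U S A] L2_bounded_L_op[OF U S A] by simp
  qed
  have p2: "L2_inner \<mu> (\<lambda>x. f x - ?L f x) f \<le> complex_of_real ((\<epsilon>\<^sup>2 + \<epsilon>) * (L2_norm \<mu> f)\<^sup>2)"
    if f: "f \<in> L2_space \<mu>" and loc: "localized \<mu> ?L \<epsilon> f" for f
  proof -
    let ?D = "\<lambda>x. f x - ?L f x" and ?r = "(L2_norm \<mu> (?c f))\<^sup>2 + (L2_norm \<mu> (?G f))\<^sup>2"
    have "L2_norm \<mu> ?D \<le> \<epsilon> * L2_norm \<mu> f"
      using loc by (subst L2_norm_minus_commute) (simp add: localized_def)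
    moreover have "?D \<in> L2_space \<mu>"
      using L2_bounded_L_op[OF U S A] f
      by (intro L2_space_diff) (auto simp: L2_bounded_def L2_linear_def)
    ultimately have "norm (L2_inner \<mu> ?D f) \<le> \<epsilon> * L2_norm \<mu> f * L2_norm \<mu> f"
      using L2_cauchy_schwarz(1)[OF _ f, of ?D] mult_right_mono[OF _ L2_norm_nonneg] order_trans
      by blast
    \<comment> \<open>By the defect formula the inner product is a nonnegative real, so the
      Cauchy-Schwarz bound on its modulus bounds its value.\<close>
    moreover have "norm (L2_inner \<mu> ?D f) = ?r"
      unfolding defect(1)[OF f] norm_of_real by simp
    ultimately have "?r \<le> \<epsilon> * (L2_norm \<mu> f)\<^sup>2"
      by (simp add: power2_eq_square mult.assoc)
    \<comment> \<open>The term \<open>\<epsilon>\<^sup>2\<close> enters as nonnegative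
      slack.\<close>
    also have "\<dots> \<le> (\<epsilon>\<^sup>2 + \<epsilon>) * (L2_norm \<mu> f)\<^sup>2"
      by (intro mult_right_mono) auto
    \<comment> \<open>The order on \<open>complex\<close> compares real parts and asks for equal
      imaginary parts; both sides are real here.\<close>
    finally show ?thesis
      unfolding defect(1)[OF f] less_eq_complex_def by simp
  qed
  have p3: "localized \<mu> ?L (sqrt \<epsilon>) f"
    if f: "L2_nonzero \<mu> f"
      and le: "L2_inner \<mu> (\<lambda>x. f x - ?L f x) f \<le> complex_of_real (\<epsilon> * (L2_norm \<mu> f)\<^sup>2)" for f
  proof -
    have f2: "f \<in> L2_space \<mu>" using f by (simp add: L2_nonzero_def)
    have "(L2_norm \<mu> (?c f))\<^sup>2 + (L2_norm \<mu> (?G f))\<^sup>2 \<le> \<epsilon> * (L2_norm \<mu> f)\<^sup>2"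
      using le unfolding defect(1)[OF f2] less_eq_complex_def by simp
    then have "(L2_norm \<mu> (\<lambda>x. f x - ?L f x))\<^sup>2 \<le> \<epsilon> * (L2_norm \<mu> f)\<^sup>2"
      using defect(2)[OF f2] by simp
    also have "\<dots> = (sqrt \<epsilon> * L2_norm \<mu> f)\<^sup>2"
      using eps by (simp add: power_mult_distrib)
    finally have "L2_norm \<mu> (\<lambda>x. f x - ?L f x) \<le> sqrt \<epsilon> * L2_norm \<mu> f"
      by (rule power2_le_imp_le) (use eps in \<open>simp add: L2_norm_nonneg\<close>)
    then show ?thesis
      using f eps L2_bounded_L_op[OF U S A] unfolding localized_def
      by (subst L2_norm_minus_commute) simp
  qed
  have p4: "L2_inner \<mu> (\<lambda>x. f x - ?L f x) f < complex_of_real ((2 * \<epsilon>1 + \<epsilon>2) * (L2_norm \<mu> f)\<^sup>2)"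
    if f: "f \<in> L2_concentrated \<mu> \<T> \<epsilon>1 \<epsilon>2 S \<Sigma>" for f
  proof -
    let ?n = "L2_norm \<mu> f"
    note f2 = conc(2)[OF f]
    have "?n \<noteq> 0"
      using conc(1)[OF f] L2_norm_eq_0_AE[OF f2] by (auto simp: L2_nonzero_def)
    then have pos: "?n > 0" using L2_norm_nonneg[of \<mu> f] by simp
    have "L2_norm \<mu> (?G f) \<le> ?n"
      using F_op_norm_le[OF U _ E_op_closed[OF S f2], of "space \<mu> - \<Sigma>"] E_op_norm_le[OF S f2] A
      by auto
    \<comment> \<open>One factor is bounded by the concentration estimate and the other only by
      \<open>?n\<close>, so that \<open>\<epsilon>1 + \<epsilon>2\<close> enters linearly.\<close>
    then have "(L2_norm \<mu> (?G f))\<^sup>2 \<le> ((\<epsilon>1 + \<epsilon>2) * ?n) * ?n"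
      unfolding power2_eq_square using bds(1)[OF f] eps pos
      by (intro mult_mono) (auto simp: L2_norm_nonneg)
    moreover have "(L2_norm \<mu> (?c f))\<^sup>2 \<le> (\<epsilon>1 * ?n)\<^sup>2"
      by (rule power_mono[OF conc(3)[OF f] L2_norm_nonneg])
    \<comment> \<open>The strictness arises here, from \<open>\<epsilon>1 < 1\<close> and
      \<open>?n > 0\<close>.\<close>
    moreover have "(\<epsilon>1 * ?n)\<^sup>2 < \<epsilon>1 * ?n\<^sup>2"
      using eps pos by (simp add: power2_eq_square)
    ultimately have "(L2_norm \<mu> (?c f))\<^sup>2 + (L2_norm \<mu> (?G f))\<^sup>2 < (2 * \<epsilon>1 + \<epsilon>2) * ?n\<^sup>2"
      by (simp add: power2_eq_square algebra_simps)
    then show ?thesis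
      unfolding defect(1)[OF f2] less_complex_def by simp
  qed
  show ?thesis using p1 p2 p3 p4 by blast
qed

end
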